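(* Assume that the linear system $\dot x=L(t)x$ is exponentially stable, and let $\mathcal{A}=(A_t)_{t\in\mathbb{R}}$ be given by $$A_t=\Big\{\rho\int_{-\infty}^t\Psi(t,s)\xi(s)\,ds : \xi\in\mathcal{U}\Big\}.$$ Then $\partial A_t$ is a $C^1$-differentiable manifold for every $t\in\mathbb{R}$.
   Context: Let $d\ge2$, $\rho>0$, $L:\mathbb{R}\to\mathbb{R}^{d\times d}$ locally integrable, and $\mathcal{U}=\{\xi\in L^\infty(\mathbb{R},\mathbb{R}^d):\|\xi\|_\infty\le1\}$. $\Psi(t,s)$ is the principal matrix solution of $\dot x=L(t)x$ at $s$ (i.e. $\Psi(s,s)=I$). Exponential stability means: there are $K\ge1$, $\gamma>0$ with $\|\Psi(t,s)\|\le Ke^{-\gamma(t-s)}$ for all $t\ge s$. $\partial A_t$ is the topological boundary of $A_t$ in $\mathbb{R}^d$. ($\mathcal{A}$ is the minimal attractor of the differential inclusion $\dot x\in\overline{B_\rho}(L(t)x)$.) *)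

theory Defs
  imports "HOL-Analysis.Analysis" "HOL-Probability.Essential_Supremum"
begin

(* Lebesgue (not just Borel) measurability is used throughout, hence the measure lebesgue. *)

definition locally_integrable :: "(real \<Rightarrow> 'a::euclidean_space) \<Rightarrow> bool" where
  "locally_integrable f \<longleftrightarrow> (\<forall>K. compact K \<longrightarrow> f absolutely_integrable_on K)"

(* Closed unit ball of L^infinity(R, R^d), by representatives.  The measurability of the vector
   valued function has to be required separately: esssup only sees its norm. *)
definition Linf_unit_ball :: "(real \<Rightarrow> 'a::euclidean_space) set" where
  "Linf_unit_ball =
     {\<xi>. \<xi> \<in> borel_measurable lebesgue \<and> esssup lebesgue (\<lambda>s. ereal (norm (\<xi> s))) \<le> 1}"

(* Psi(., s) is the solution of x' = L(t) x with Psi(s, s) = I, in the sense of Caratheodory since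
   L is merely locally integrable: a continuous solution of the integral equation.
   The integral is oriented, so that t < s is covered as well; continuity guarantees that the
   integrand is integrable. *)
definition principal_matrix_solution ::
    "(real \<Rightarrow> real^'n^'n) \<Rightarrow> (real \<Rightarrow> real \<Rightarrow> real^'n^'n) \<Rightarrow> bool" where
  "principal_matrix_solution L \<Psi> \<longleftrightarrow>
     (\<forall>s. continuous_on UNIV (\<lambda>t. \<Psi> t s) \<and>
          (\<forall>t. \<Psi> t s = mat 1 + (LINT u=ereal s..ereal t|lebesgue. (L u ** \<Psi> u s))))"

(* onorm gives the operator norm; norm on real^'n^'n would be the Frobenius norm. *)
definition exponentially_stable :: "(real \<Rightarrow> real \<Rightarrow> real^'n^'n) \<Rightarrow> bool" where
  "exponentially_stable \<Psi> \<longleftrightarrow>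
     (\<exists>K \<gamma>. K \<ge> 1 \<and> \<gamma> > 0 \<and>
        (\<forall>t s. s \<le> t \<longrightarrow> onorm (\<lambda>v. \<Psi> t s *v v) \<le> K * exp (- \<gamma> * (t - s))))"

definition attractor_fibre ::
    "real \<Rightarrow> (real \<Rightarrow> real \<Rightarrow> real^'n^'n) \<Rightarrow> real \<Rightarrow> (real^'n) set" where
  "attractor_fibre \<rho> \<Psi> t =
     {\<rho> *\<^sub>R (LINT s:{..t}|lebesgue. \<Psi> t s *v \<xi> s) | \<xi>. \<xi> \<in> Linf_unit_ball}"

definition C1_map_on ::
    "'a::real_normed_vector set \<Rightarrow> ('a \<Rightarrow> 'b::real_normed_vector) \<Rightarrow> bool" where
  "C1_map_on U f \<longleftrightarrow>
     (\<exists>f' :: 'a \<Rightarrow> 'a \<Rightarrow>\<^sub>L 'b.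
        (\<forall>x\<in>U. (f has_derivative blinfun_apply (f' x)) (at x)) \<and> continuous_on U f')"

(* Embedded k-dimensional C^1 submanifold of a Euclidean space, by slice charts: near each of its
   points, a C^1 diffeomorphism phi between open sets (with inverse psi) flattens M onto a
   k-dimensional linear subspace S. *)
definition C1_submanifold :: "nat \<Rightarrow> 'a::euclidean_space set \<Rightarrow> bool" where
  "C1_submanifold k M \<longleftrightarrow>
     (\<forall>p\<in>M. \<exists>(U::'a set) (V::'a set) \<phi> \<psi> S.
        open U \<and> p \<in> U \<and> open V \<and>
        homeomorphism U V \<phi> \<psi> \<and> C1_map_on U \<phi> \<and> C1_map_on V \<psi> \<and>
        subspace S \<and> dim S = k \<and> \<phi> ` (U \<inter> M) = V \<inter> S)"

end

theory Submission
  imports Defs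
begin

text \<open>The support function of \<open>A\<^sub>t\<close> is \<open>h r = \<rho> \<integral> norm (\<Psi>(t,s)\<^sup>T r) ds\<close>, integrated over \<open>s \<le> t\<close>
  and attained at the control \<open>\<xi> s = sgn (\<Psi>(t,s)\<^sup>T r)\<close>.  It is a norm, and it is strictly convex:
  the integrand is continuous in \<open>s\<close>, so equality in the triangle inequality for \<open>h\<close> forces equality
  at \<open>s = t\<close>, where \<open>\<Psi>(t,t)\<close> is the identity.  Hence the polar body \<open>{h \<le> 1}\<close> contains a unique
  maximiser \<open>q x\<close> of \<open>r \<mapsto> r \<bullet> x\<close> for each \<open>x \<noteq> 0\<close>.  It depends continuously on \<open>x\<close> and is the gradient
  of the gauge \<open>g x = q x \<bullet> x\<close> of \<open>A\<^sub>t\<close>, so the boundary \<open>{g = 1}\<close> is a level set of a homogeneous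
  \<open>C\<^sup>1\<close> function.  The support function itself need not be twice differentiable, which is why the
  boundary is described by the gauge and not parametrised by its normals.\<close>

subsection \<open>Convex sets with strictly convex support function\<close>

text \<open>In finite dimensions, convergence of linear maps in operator norm is convergence on each
  basis vector. Pointwise continuity of the derivative is thus enough, and derivatives can be
  written as plain functions.\<close>

lemma C1_map_onI:
  fixes f :: "'a::euclidean_space \<Rightarrow> 'b::real_normed_vector"
  assumes der: "\<And>x. x \<in> U \<Longrightarrow> (f has_derivative f' x) (at x)"
    and cont: "\<And>v. continuous_on U (\<lambda>x. f' x v)"
  shows "C1_map_on U f"
  unfolding C1_map_on_def
proof (intro exI conjI ballI)
  have eq: "blinfun_apply (Blinfun (f' x)) = f' x" if "x \<in> U" for x
    by (rule bounded_linear_Blinfun_apply) (rule has_derivative_bounded_linear[OF der[OF that]])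
  show "(f has_derivative blinfun_apply (Blinfun (f' x))) (at x)" if "x \<in> U" for x
    using der[OF that] eq[OF that] by simp
  show "continuous_on U (\<lambda>x. Blinfun (f' x))"
    by (rule continuous_on_blinfun_componentwise)
       (rule continuous_on_eq[OF cont], simp add: eq)
qed

text \<open>Maximality is a closed condition on pairs \<open>(x, r)\<close>, and uniqueness makes
  the pairs satisfying it exactly the graph of \<open>q\<close>. A map into a compact set with
  closed graph is continuous.\<close>

lemma continuous_on_argmax_inner:
  fixes q :: "'a::euclidean_space \<Rightarrow> 'a"
  assumes P: "compact P"
    and max: "\<And>x r. x \<in> S \<Longrightarrow> r \<in> P \<Longrightarrow> r \<bullet> x \<le> q x \<bullet> x"
    and qP: "\<And>x. x \<in> S \<Longrightarrow> q x \<in> P"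
    and uniq: "\<And>x r. x \<in> S \<Longrightarrow> r \<in> P \<Longrightarrow> r \<bullet> x = q x \<bullet> x \<Longrightarrow> r = q x"
  shows "continuous_on S q"
proof -
  have "closed {y::'a \<times> 'a. s \<bullet> fst y \<le> snd y \<bullet> fst y}" for s
    by (intro closed_Collect_le continuous_intros)
  then have "closed (\<Inter>s\<in>P. {y::'a \<times> 'a. s \<bullet> fst y \<le> snd y \<bullet> fst y})"
    by auto
  then have "closedin (top_of_set (S \<times> P))
      ((S \<times> P) \<inter> (\<Inter>s\<in>P. {y::'a \<times> 'a. s \<bullet> fst y \<le> snd y \<bullet> fst y}))"
    by (rule closedin_closed_Int)
  also have "(S \<times> P) \<inter> (\<Inter>s\<in>P. {y::'a \<times> 'a. s \<bullet> fst y \<le> snd y \<bullet> fst y}) = (\<lambda>x. (x, q x)) ` S"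
  proof (intro equalityI subsetI)
    fix y assume y: "y \<in> (S \<times> P) \<inter> (\<Inter>s\<in>P. {y. s \<bullet> fst y \<le> snd y \<bullet> fst y})"
    obtain x r where xr: "y = (x, r)" by (cases y)
    have x: "x \<in> S" and r: "r \<in> P" "q x \<bullet> x \<le> r \<bullet> x"
      using y xr qP[of x] by auto
    then have "r = q x" using max[OF x r(1)] by (intro uniq) auto
    then show "y \<in> (\<lambda>x. (x, q x)) ` S" using xr x by simp
  qed (use max qP in auto)
  finally show ?thesis
    using continuous_closed_graph_eq[OF P, of q S] qP by auto
qed

text \<open>An envelope theorem: comparing the maximisers at \<open>x\<close> and \<open>y\<close>
  traps the remainder between 0 and \<open>(q y - q x) \<bullet> (y - x)\<close>, so continuity of
  \<open>q\<close> already yields differentiability of the maximum.\<close>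

lemma has_derivative_max_inner:
  fixes q :: "'a::real_inner \<Rightarrow> 'a"
  assumes S: "open S" "x \<in> S"
    and max: "\<And>x y. x \<in> S \<Longrightarrow> y \<in> S \<Longrightarrow> q y \<bullet> x \<le> q x \<bullet> x"
    and cont: "continuous_on S q"
  shows "((\<lambda>x. q x \<bullet> x) has_derivative (\<lambda>v. q x \<bullet> v)) (at x)"
proof -
  obtain e where e: "e > 0" "ball x e \<subseteq> S"
    using S openE by blast
  have "isCont q x"
    using cont S continuous_on_eq_continuous_at by blast
  then have "((\<lambda>y. norm (q y - q x)) \<longlongrightarrow> norm (q x - q x)) (at x)"
    unfolding isCont_def by (intro tendsto_intros)
  then have lim: "((\<lambda>y. norm (q y - q x)) \<longlongrightarrow> 0) (at x)" by simp
  have bound: "norm (q y \<bullet> y - q x \<bullet> x - q x \<bullet> (y - x)) / norm (y - x) \<le> norm (q y - q x)"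
    if y: "y \<in> UNIV" "y \<noteq> x" "dist y x < e" for y
  proof -
    have yS: "y \<in> S" using e y by (auto simp: dist_commute)
    have 1: "q x \<bullet> y \<le> q y \<bullet> y" "q y \<bullet> x \<le> q x \<bullet> x"
      using max yS S by auto
    have "norm (q y \<bullet> y - q x \<bullet> x - q x \<bullet> (y - x)) = q y \<bullet> y - q x \<bullet> y"
      using 1 by (simp add: inner_diff_right)
    \<comment> \<open>The two sides differ by \<open>q x \<bullet> x - q y \<bullet> x\<close>,
      which is nonnegative.\<close>
    also have "\<dots> \<le> (q y - q x) \<bullet> (y - x)"
      using 1 by (simp add: inner_diff_right inner_diff_left)
    also have "\<dots> \<le> norm (q y - q x) * norm (y - x)"
      by (rule norm_cauchy_schwarz)
    finally show ?thesis
      using y by (simp add: divide_simps)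
  qed
  show ?thesis
    by (rule has_derivativeI_sandwich[OF e(1) bounded_linear_inner_right bound lim])
qed

text \<open>The chart around \<open>p0\<close> measures the radial coordinate by the gauge and the direction by central
  projection to the hyperplane through \<open>p = p0 / norm p0\<close> orthogonal to \<open>p\<close>.  Homogeneity makes
  its inverse explicit, so that no inverse function theorem is needed.\<close>
lemma C1_submanifold_unit_sphere_gauge:
  fixes g :: "'a::euclidean_space \<Rightarrow> real"
  assumes der: "\<And>x. x \<noteq> 0 \<Longrightarrow> (g has_derivative (\<lambda>v. q x \<bullet> v)) (at x)"
    and cont: "continuous_on (- {0}) q"
    and hom: "\<And>c x. c > 0 \<Longrightarrow> g (c *\<^sub>R x) = c * g x"
    and pos: "\<And>x. x \<noteq> 0 \<Longrightarrow> g x > 0"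
    and zero: "g 0 = 0"
  shows "C1_submanifold (DIM('a) - 1) {x. g x = 1}"
  unfolding C1_submanifold_def
proof
  fix p0 assume "p0 \<in> {x. g x = 1}"
  then have p0: "p0 \<noteq> 0" using zero by auto
  define p where "p = p0 /\<^sub>R norm p0"
  have p: "p \<bullet> p = 1" using p0 by (simp add: p_def dot_square_norm power2_eq_square)
  define U where "U = {x. x \<bullet> p > 0}"
  define V where "V = {z. z \<bullet> p > -1}"
  \<comment> \<open>\<open>w z\<close> lies on the affine hyperplane of points whose inner product
    with \<open>p\<close> is 1, and has the same component orthogonal to \<open>p\<close> as
    \<open>z\<close>.\<close>
  define w where "w = (\<lambda>z. p + z - (z \<bullet> p) *\<^sub>R p)"
  \<comment> \<open>The shifts by 1 and by \<open>p\<close> move the level set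
    \<open>g x = 1\<close> onto a hyperplane through the origin, as a slice chart requires.\<close>
  define \<phi> where "\<phi> = (\<lambda>x. (g x - 1) *\<^sub>R p + (inverse (x \<bullet> p) *\<^sub>R x - p))"
  \<comment> \<open>The point on the ray through \<open>w z\<close> whose gauge is
    \<open>1 + z \<bullet> p\<close>; \<open>V\<close> is the half-space where this value is
    positive.\<close>
  define \<psi> where "\<psi> = (\<lambda>z. ((1 + z \<bullet> p) * inverse (g (w z))) *\<^sub>R w z)"
  have U0: "x \<noteq> 0" "x \<bullet> p \<noteq> 0" if "x \<in> U" for x using that by (auto simp: U_def)
  have wp: "w z \<bullet> p = 1" for z by (simp add: w_def inner_simps p)
  have w0: "w z \<noteq> 0" for z using wp[of z] by auto
  have gw: "g (w z) > 0" for z using pos[OF w0] .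
  have \<phi>p: "\<phi> x \<bullet> p = g x - 1" if "x \<in> U" for x
    using U0[OF that] by (simp add: \<phi>_def inner_simps p)
  have w\<phi>: "w (\<phi> x) = inverse (x \<bullet> p) *\<^sub>R x" if "x \<in> U" for x
    using \<phi>p[OF that] by (simp add: w_def) (simp add: \<phi>_def algebra_simps)
  have \<psi>p: "\<psi> z \<bullet> p = (1 + z \<bullet> p) * inverse (g (w z))" for z by (simp add: \<psi>_def wp)
  have \<psi>U: "\<psi> z \<in> U" if "z \<in> V" for z
    using that gw[of z] by (simp add: U_def V_def \<psi>p)
  have g\<psi>: "g (\<psi> z) = 1 + z \<bullet> p" if "z \<in> V" for z
    using that gw[of z] by (simp add: \<psi>_def hom V_def)
  have \<psi>\<phi>: "\<psi> (\<phi> x) = x" if "x \<in> U" for x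
  proof -
    have "x \<bullet> p > 0" using that by (simp add: U_def)
    then show ?thesis
      using U0[OF that] pos[of x] by (simp add: \<psi>_def w\<phi>[OF that] \<phi>p[OF that] hom field_simps)
  qed
  have \<phi>\<psi>: "\<phi> (\<psi> z) = z" if "z \<in> V" for z
  proof -
    have "(1 + z \<bullet> p) * inverse (g (w z)) \<noteq> 0"
      using that gw[of z] by (auto simp: V_def)
    then have "inverse (\<psi> z \<bullet> p) *\<^sub>R \<psi> z = w z"
      unfolding \<psi>p unfolding \<psi>_def scaleR_scaleR by (subst left_inverse) auto
    then show ?thesis by (simp add: \<phi>_def g\<psi>[OF that]) (simp add: w_def)
  qed
  have \<phi>V: "\<phi> x \<in> V" if "x \<in> U" for x
    using \<phi>p[OF that] pos[OF U0(1)[OF that]] by (simp add: V_def)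
  have contg: "continuous_on (- {0}) g"
    by (rule continuous_at_imp_continuous_on) (blast intro: has_derivative_continuous der)
  have C\<phi>: "C1_map_on U \<phi>"
  proof (rule C1_map_onI)
    fix x assume x: "x \<in> U"
    show "(\<phi> has_derivative (\<lambda>v. (q x \<bullet> v) *\<^sub>R p + (inverse (x \<bullet> p) *\<^sub>R v
             + (- (inverse (x \<bullet> p) * (v \<bullet> p) * inverse (x \<bullet> p))) *\<^sub>R x))) (at x)"
      unfolding \<phi>_def using U0[OF x]
      by (auto intro!: derivative_eq_intros der)
  next
    have "continuous_on U q" by (rule continuous_on_subset[OF cont]) (use U0 in auto)
    then show "continuous_on U (\<lambda>x. (q x \<bullet> v) *\<^sub>R p + (inverse (x \<bullet> p) *\<^sub>R v
             + (- (inverse (x \<bullet> p) * (v \<bullet> p) * inverse (x \<bullet> p))) *\<^sub>R x))" for v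
      by (intro continuous_intros) (use U0 in auto)
  qed
  have contw: "continuous_on T w" for T unfolding w_def by (intro continuous_intros)
  have derw: "(w has_derivative (\<lambda>v. v - (v \<bullet> p) *\<^sub>R p)) (at z)" for z
    unfolding w_def by (auto intro!: derivative_eq_intros)
  have contqw: "continuous_on V (\<lambda>z. q (w z))"
    by (rule continuous_on_compose2[OF cont contw]) (use w0 in auto)
  have contgw: "continuous_on V (\<lambda>z. g (w z))"
    by (rule continuous_on_compose2[OF contg contw]) (use w0 in auto)
  have C\<psi>: "C1_map_on V \<psi>"
  proof (rule C1_map_onI)
    fix z assume z: "z \<in> V"
    have gw': "((\<lambda>z. g (w z)) has_derivative (\<lambda>v. q (w z) \<bullet> (v - (v \<bullet> p) *\<^sub>R p))) (at z)"
      by (rule has_derivative_compose[OF derw der[OF w0]])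
    show "(\<psi> has_derivative (\<lambda>v. ((1 + z \<bullet> p) * inverse (g (w z))) *\<^sub>R (v - (v \<bullet> p) *\<^sub>R p)
        + ((1 + z \<bullet> p) * (- (inverse (g (w z)) * (q (w z) \<bullet> (v - (v \<bullet> p) *\<^sub>R p)) * inverse (g (w z))))
            + (v \<bullet> p) * inverse (g (w z))) *\<^sub>R w z)) (at z)"
      unfolding \<psi>_def using gw[of z] 
      by (auto intro!: derivative_eq_intros derw gw')
  next
    show "continuous_on V (\<lambda>z. ((1 + z \<bullet> p) * inverse (g (w z))) *\<^sub>R (v - (v \<bullet> p) *\<^sub>R p)
        + ((1 + z \<bullet> p) * (- (inverse (g (w z)) * (q (w z) \<bullet> (v - (v \<bullet> p) *\<^sub>R p)) * inverse (g (w z))))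
            + (v \<bullet> p) * inverse (g (w z))) *\<^sub>R w z)" for v
      by (intro continuous_intros contw contqw contgw) (use gw in \<open>auto simp: less_le\<close>)
  qed
  have C1_cont: "continuous_on T f" if "C1_map_on T f" for T and f :: "'a \<Rightarrow> 'a"
    using that unfolding C1_map_on_def
    by (intro continuous_at_imp_continuous_on) (blast intro: has_derivative_continuous)
  show "\<exists>U (V::'a set) \<phi> \<psi> S. open U \<and> p0 \<in> U \<and> open V \<and> homeomorphism U V \<phi> \<psi> \<and>
          C1_map_on U \<phi> \<and> C1_map_on V \<psi> \<and> subspace S \<and> dim S = DIM('a) - 1 \<and>
          \<phi> ` (U \<inter> {x. g x = 1}) = V \<inter> S"
  proof (rule exI[of _ U], rule exI[of _ V], rule exI[of _ \<phi>], rule exI[of _ \<psi>],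
      rule exI[of _ "{z. p \<bullet> z = 0}"], intro conjI)
    show "open U" "open V"
      unfolding U_def V_def by (auto intro!: open_Collect_less continuous_intros)
    show "p0 \<in> U" using p0 by (simp add: U_def p_def)
    show "homeomorphism U V \<phi> \<psi>"
      by (rule homeomorphismI[OF C1_cont[OF C\<phi>] C1_cont[OF C\<psi>]]) (auto simp: \<phi>V \<psi>U \<phi>\<psi> \<psi>\<phi>)
    show "subspace {z. p \<bullet> z = 0}" by (rule subspace_hyperplane)
    show "dim {z. p \<bullet> z = 0} = DIM('a) - 1"
      using p by (intro dim_hyperplane) auto
    show "\<phi> ` (U \<inter> {x. g x = 1}) = V \<inter> {z. p \<bullet> z = 0}"
    proof (intro equalityI subsetI)
      fix z assume "z \<in> \<phi> ` (U \<inter> {x. g x = 1})"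
      then show "z \<in> V \<inter> {z. p \<bullet> z = 0}" using \<phi>V \<phi>p by (auto simp: inner_commute)
    next
      fix z assume z: "z \<in> V \<inter> {z. p \<bullet> z = 0}"
      then have "\<psi> z \<in> U \<inter> {x. g x = 1}" using \<psi>U g\<psi> by (auto simp: inner_commute)
      then show "z \<in> \<phi> ` (U \<inter> {x. g x = 1})" using \<phi>\<psi> z by (metis IntD1 imageI)
    qed
  qed (fact C\<phi> C\<psi>)+
qed

text \<open>An interior point can be stretched by some factor \<open>c > 1\<close> without leaving
  the set, so homogeneity gives \<open>g x \<le> 1 / c < 1\<close> there.\<close>

lemma frontier_sublevel_gauge:
  fixes g :: "'a::real_normed_vector \<Rightarrow> real"
  assumes cont: "continuous_on UNIV g"
    and hom: "\<And>c x. c > 0 \<Longrightarrow> g (c *\<^sub>R x) = c * g x"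
  shows "frontier {x. g x \<le> 1} = {x. g x = 1}"
proof -
  have cl: "closed {x. g x \<le> 1}" and op: "open {x. g x < 1}"
    using cont by (intro closed_Collect_le open_Collect_less continuous_on_const; assumption)+
  have "g x < 1" if x: "x \<in> interior {x. g x \<le> 1}" for x
  proof -
    have "((\<lambda>c. c *\<^sub>R x) \<longlongrightarrow> 1 *\<^sub>R x) (at_right 1)" by (intro tendsto_intros)
    then have "\<forall>\<^sub>F c in at_right 1. c *\<^sub>R x \<in> interior {x. g x \<le> 1}"
      using x by (intro topological_tendstoD) auto
    moreover have "\<forall>\<^sub>F c in at_right (1::real). c > 1" by (rule eventually_at_right_less)
    ultimately have "\<forall>\<^sub>F c in at_right 1. c > 1 \<and> g (c *\<^sub>R x) \<le> 1"
      by eventually_elim (use interior_subset in fastforce)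
    then obtain c where c: "c > 1" "g (c *\<^sub>R x) \<le> 1"
      using eventually_happens'[OF trivial_limit_at_right_real] by blast
    then have "c * g x \<le> 1" by (simp add: hom)
    then have "g x \<le> 1 / c" using c by (simp add: field_simps)
    also have "\<dots> < 1" using c by simp
    finally show ?thesis .
  qed
  then have "interior {x. g x \<le> 1} = {x. g x < 1}"
    using op interior_maximal[OF _ op, of "{x. g x \<le> 1}"] by fastforce
  then show ?thesis using cl by (auto simp: frontier_def)
qed

text \<open>\<open>attained\<close> acts twice: it makes \<open>h\<close> sublinear, as a maximum of
  linear functionals, and it lets separating hyperplanes identify the closure of \<open>A\<close>
  with \<open>{g \<le> 1}\<close>. \<open>strict\<close> is what makes maximisers over the polar
  body unique.\<close>

lemma C1_submanifold_frontier_support: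
  fixes A :: "'a::euclidean_space set" and h :: "'a \<Rightarrow> real"
  assumes conv: "convex A"
    and le: "\<And>a r. a \<in> A \<Longrightarrow> r \<bullet> a \<le> h r"
    and attained: "\<And>r. \<exists>a\<in>A. r \<bullet> a = h r"
    and pos: "\<And>r. r \<noteq> 0 \<Longrightarrow> h r > 0"
    and strict: "\<And>r s. h (r + s) = h r + h s \<Longrightarrow> norm r *\<^sub>R s = norm s *\<^sub>R r"
  shows "C1_submanifold (DIM('a) - 1) (frontier A)"
proof -
  have tri: "h (r + s) \<le> h r + h s" for r s
    using attained[of "r + s"] le[of _ r] le[of _ s] by (fastforce simp: inner_add_left)
  have hom: "h (c *\<^sub>R r) = c * h r" if "c \<ge> 0" for c r
  proof (rule antisym)
    obtain a where "a \<in> A" "(c *\<^sub>R r) \<bullet> a = h (c *\<^sub>R r)" using attained by blast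
    then show "h (c *\<^sub>R r) \<le> c * h r" using le[of a r] that by (metis inner_scaleR_left mult_left_mono)
    obtain a where "a \<in> A" "r \<bullet> a = h r" using attained by blast
    then show "c * h r \<le> h (c *\<^sub>R r)" using le[of a "c *\<^sub>R r"] by simp
  qed
  have h0: "h 0 = 0" using hom[of 0] by simp
  have "convex_on UNIV h"
    by (intro convex_onI) (auto intro!: order_trans[OF tri] simp: hom)
  then have conth: "continuous_on UNIV h" by (intro convex_on_continuous) auto
  define P where "P = {r. h r \<le> 1}"
  have "closed P" unfolding P_def using conth by (intro closed_Collect_le) auto
  moreover have "bounded P"
  proof -
    \<comment> \<open>\<open>m\<close> is the minimum of \<open>h\<close> on the unit sphere; by
      homogeneity \<open>P\<close> lies in the ball of radius \<open>1 / m\<close>.\<close>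
    obtain m where m: "m > 0" "\<And>r. norm r = 1 \<Longrightarrow> m \<le> h r"
    proof -
      have "\<exists>u\<in>sphere (0::'a) 1. \<forall>y\<in>sphere 0 1. h u \<le> h y"
        by (rule continuous_attains_inf) (auto intro: continuous_on_subset[OF conth])
      then obtain u where u: "norm u = 1" "\<And>y. norm y = 1 \<Longrightarrow> h u \<le> h y" by auto
      then show ?thesis using pos[of u] that[of "h u"] by fastforce
    qed
    have "norm r \<le> 1 / m" if "r \<in> P" for r
    proof (cases "r = 0")
      case False
      have "m \<le> h (r /\<^sub>R norm r)" by (rule m) (use False in simp)
      also have "\<dots> = h r / norm r" by (subst hom) (auto simp: field_simps)
      finally have "m * norm r \<le> h r" using False by (simp add: field_simps)
      then show ?thesis using that m by (simp add: P_def field_simps)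
    qed (use m in simp)
    then show ?thesis unfolding bounded_iff by blast
  qed
  ultimately have cP: "compact P" by (simp add: compact_eq_bounded_closed)
  have "\<exists>r\<in>P. \<forall>s\<in>P. s \<bullet> x \<le> r \<bullet> x" for x
    by (rule continuous_attains_sup[OF cP]) (auto simp: P_def h0 intro!: continuous_intros exI[of _ 0])
  then obtain q where qP: "\<And>x. q x \<in> P" and qmax: "\<And>x s. s \<in> P \<Longrightarrow> s \<bullet> x \<le> q x \<bullet> x"
    by metis
  define g where "g = (\<lambda>x. q x \<bullet> x)"
  \<comment> \<open>The Cauchy-Schwarz inequality for the dual pair \<open>h\<close>,
    \<open>g\<close>: rescale \<open>r\<close> to the boundary of \<open>P\<close>.\<close>
  have inner_le: "r \<bullet> x \<le> h r * g x" for r x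
  proof (cases "r = 0")
    case False
    have "h (inverse (h r) *\<^sub>R r) = 1" using pos[OF False] by (simp add: hom)
    then have "(inverse (h r) *\<^sub>R r) \<bullet> x \<le> g x" unfolding g_def by (intro qmax) (simp add: P_def)
    then show ?thesis using pos[OF False] by (simp add: field_simps)
  qed (simp add: h0)
  have gpos: "g x > 0" if "x \<noteq> 0" for x
  proof -
    have "0 < x \<bullet> x" using that by simp
    also have "\<dots> \<le> h x * g x" by (rule inner_le)
    finally show ?thesis using pos[OF that] by (simp add: zero_less_mult_iff)
  qed
  have g0: "g 0 = 0" by (simp add: g_def)
  have ghom: "g (c *\<^sub>R x) = c * g x" if "c > 0" for c x
    using qmax[OF qP[of x], of "c *\<^sub>R x"] qmax[OF qP[of "c *\<^sub>R x"], of x] that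
    by (simp add: g_def) 
  have maximizer_h: "h r = 1" if "x \<noteq> 0" "r \<in> P" "r \<bullet> x = g x" for r x
    using inner_le[of r x] gpos[OF that(1)] that(2,3) by (auto simp: P_def)
  have uniq: "r = q x" if x: "x \<noteq> 0" and r: "r \<in> P" "r \<bullet> x = g x" for r x
  proof -
    have h1: "h r = 1" "h (q x) = 1" using maximizer_h[OF x] r qP[of x] by (auto simp: g_def)
    \<comment> \<open>Two maximisers both have \<open>h = 1\<close>, and their sum then has
      \<open>h\<close> at least 2. This is equality in the triangle inequality, so they are
      parallel, and equal values of \<open>h\<close> make them equal.\<close>
    have "2 * g x \<le> h (r + q x) * g x"
      using inner_le[of "r + q x" x] r(2) by (simp add: inner_add_left g_def)
    then have "2 \<le> h (r + q x)" using gpos[OF x] by simp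
    then have eq: "norm r *\<^sub>R q x = norm (q x) *\<^sub>R r"
      using tri[of r "q x"] h1 by (intro strict) auto
    then have "norm r * h (q x) = norm (q x) * h r" by (metis hom norm_ge_zero)
    then have "norm r = norm (q x)" using h1 by simp
    moreover have "r \<noteq> 0" using h1 h0 by auto
    ultimately show ?thesis using eq by auto
  qed
  have contq: "continuous_on (- {0}) q"
    by (rule continuous_on_argmax_inner[OF cP]) (use qmax qP uniq in \<open>auto simp: g_def\<close>)
  have der: "(g has_derivative (\<lambda>v. q x \<bullet> v)) (at x)" if "x \<noteq> 0" for x
    unfolding g_def by (rule has_derivative_max_inner[OF _ _ _ contq]) (use that qmax qP in auto)
  \<comment> \<open>Convexity supplies continuity of \<open>g\<close> at the origin too, where
    \<open>der\<close> says nothing.\<close>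
  have "convex_on UNIV g"
  proof (rule convex_onI)
    fix t x y assume t: "0 < t" "t < (1::real)"
    show "g ((1 - t) *\<^sub>R x + t *\<^sub>R y) \<le> (1 - t) * g x + t * g y"
      using qmax[OF qP, of "(1 - t) *\<^sub>R x + t *\<^sub>R y" x] qmax[OF qP, of "(1 - t) *\<^sub>R x + t *\<^sub>R y" y] t
      by (auto simp: g_def inner_add_right intro!: add_mono mult_left_mono)
  qed auto
  then have contg: "continuous_on UNIV g" by (intro convex_on_continuous) auto
  have clA: "closure A = {x. g x \<le> 1}"
  proof
    have "A \<subseteq> {x. g x \<le> 1}"
    proof
      fix a assume "a \<in> A"
      then have "g a \<le> h (q a)" unfolding g_def by (rule le)
      then show "a \<in> {x. g x \<le> 1}" using qP[of a] by (auto simp: P_def)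
    qed
    moreover have "closed {x. g x \<le> 1}" using contg by (intro closed_Collect_le continuous_on_const)
    ultimately show "closure A \<subseteq> {x. g x \<le> 1}" by (rule closure_minimal)
  next
    show "{x. g x \<le> 1} \<subseteq> closure A"
    proof (rule subsetI, rule ccontr)
      fix x assume x: "x \<in> {x. g x \<le> 1}" "x \<notin> closure A"
      then obtain c b where cb: "c \<bullet> x < b" "\<And>y. y \<in> closure A \<Longrightarrow> c \<bullet> y > b"
        using separating_hyperplane_closed_point[of "closure A" x] conv by (auto simp: convex_closure)
      \<comment> \<open>The hyperplane bounds \<open>A\<close> from below in direction
        \<open>c\<close>, hence the sign: the support value in direction \<open>- c\<close> is
        smaller than the value at \<open>x\<close>, contradicting \<open>inner_le\<close> with
        \<open>g x \<le> 1\<close>.\<close>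
      obtain a where a: "a \<in> A" "(- c) \<bullet> a = h (- c)" using attained by blast
      then have lt: "h (- c) < (- c) \<bullet> x" using cb(1) cb(2)[of a] closure_subset by fastforce
      also have "\<dots> \<le> h (- c) * g x" by (rule inner_le)
      also have "\<dots> \<le> h (- c)" using x pos[of "- c"] h0
        by (cases "c = 0") (auto intro: mult_left_le)
      finally show False by simp
    qed
  qed
  \<comment> \<open>Only the closure has been identified with a sublevel set; a convex set and its
    closure have the same interior.\<close>
  have "frontier A = frontier (closure A)"
    using convex_interior_closure[OF conv] by (simp add: frontier_def)
  also have "\<dots> = {x. g x = 1}"
    unfolding clA by (rule frontier_sublevel_gauge[OF contg ghom])
  finally show ?thesis
    using C1_submanifold_unit_sphere_gauge[OF der contq ghom gpos g0] by simp
qed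

subsection \<open>Linear Caratheodory equations\<close>

text \<open>The equation is posed between any two ordered times instead of from a fixed start. This
  avoids oriented integrals and lets uniqueness be argued from any zero of a solution.\<close>

definition linear_ode_solution :: "(real \<Rightarrow> real^'n^'n) \<Rightarrow> (real \<Rightarrow> real^'n) \<Rightarrow> bool" where
  "linear_ode_solution L x \<longleftrightarrow> continuous_on UNIV x \<and>
     (\<forall>a b. a \<le> b \<longrightarrow> ((\<lambda>u. L u *v x u) has_integral (x b - x a)) {a..b})"

lemma bilinear_matrix_vector_mult: "bilinear ((*v) :: real^'n^'m \<Rightarrow> real^'n \<Rightarrow> real^'m)"
  unfolding bilinear_def
  by (auto intro!: linearI simp: matrix_vector_mult_add_rdistrib matrix_vector_right_distrib
      scaleR_matrix_vector_assoc matrix_vector_mult_scaleR)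

lemma bilinear_matrix_matrix_mult:
  "bilinear ((**) :: real^'n^'m \<Rightarrow> real^'k^'n \<Rightarrow> real^'k^'m)"
  unfolding bilinear_def
  by (auto intro!: linearI simp: matrix_matrix_mult_def vec_eq_iff sum.distrib
      sum_distrib_left algebra_simps)

lemma linear_ode_solution_diff:
  assumes "linear_ode_solution L x" "linear_ode_solution L y"
  shows "linear_ode_solution L (\<lambda>u. x u - y u)"
  unfolding linear_ode_solution_def
proof (intro conjI allI impI)
  show "continuous_on UNIV (\<lambda>u. x u - y u)"
    using assms by (auto simp: linear_ode_solution_def intro: continuous_on_diff)
  fix a b :: real assume "a \<le> b"
  then have "((\<lambda>u. L u *v x u - L u *v y u) has_integral (x b - x a - (y b - y a))) {a..b}"
    using assms by (intro has_integral_diff) (auto simp: linear_ode_solution_def)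
  then show "((\<lambda>u. L u *v (x u - y u)) has_integral (x b - y b - (x a - y a))) {a..b}"
    by (simp add: matrix_vector_mult_diff_distrib algebra_simps)
qed

text \<open>The zero set is closed, and open because the integral operator is a contraction on short
  intervals.\<close>
lemma linear_ode_solution_unique:
  assumes L: "locally_integrable L" and x: "linear_ode_solution L x" and "x s = 0"
  shows "x t = 0"
proof -
  define Z where "Z = {u. x u = 0}"
  have contx: "continuous_on UNIV x"
    and xint: "\<And>a b. a \<le> b \<Longrightarrow> ((\<lambda>u. L u *v x u) has_integral (x b - x a)) {a..b}"
    using x by (auto simp: linear_ode_solution_def)
  have "closed Z"
    unfolding Z_def using contx by (intro closed_Collect_eq) auto
  have "bounded_bilinear ((*v) :: real^'a^'a \<Rightarrow> real^'a \<Rightarrow> real^'a)"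
    using bilinear_matrix_vector_mult bilinear_conv_bounded_bilinear by blast
  then obtain K where K: "K > 0"
      "\<And>(A::real^'a^'a) v. norm (A *v v) \<le> norm A * norm v * K"
    using bounded_bilinear.pos_bounded by metis
  have "open Z"
    unfolding open_dist
  proof (intro ballI)
    fix z assume "z \<in> Z"
    then have z: "x z = 0" by (simp add: Z_def)
    define f where "f = (\<lambda>u. norm (L u))"
    have "L absolutely_integrable_on {z-1..z+1}"
      using L by (auto simp: locally_integrable_def)
    then have f: "f integrable_on {z-1..z+1}"
      by (simp add: f_def absolutely_integrable_on_def)
    \<comment> \<open>\<open>L\<close> may be unbounded near \<open>z\<close>; continuity of the
      integral of its norm replaces a bound on \<open>L\<close>.\<close>
    define F where "F = (\<lambda>u. integral {z-1..u} f)"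
    have "continuous_on {z-1..z+1} F"
      unfolding F_def by (rule indefinite_integral_continuous_1[OF f])
    then have "isCont F z"
      by (rule continuous_on_interior) auto
    moreover have "1 / (2 * K) > 0" using K by simp
    \<comment> \<open>With \<open>K\<close> the constant of the matrix-vector product, the tolerance
      \<open>1 / (2 * K)\<close> yields contraction factor 1/2.\<close>
    ultimately obtain d0 where d0: "d0 > 0" "\<And>u. dist u z < d0 \<Longrightarrow> dist (F u) (F z) < 1 / (2 * K)"
      unfolding continuous_at_eps_delta by blast
    \<comment> \<open>Halving \<open>d0\<close> keeps the closed interval inside the open ball; the
      bound 1/2 keeps it inside \<open>{z-1..z+1}\<close>.\<close>
    define d where "d = min (d0 / 2) (1/2)"
    have d: "d > 0" "d < 1" "d < d0" using d0 by (auto simp: d_def)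
    have "\<exists>m\<in>{z-d..z+d}. \<forall>u\<in>{z-d..z+d}. norm (x u) \<le> norm (x m)"
      using d by (intro continuous_attains_sup) (auto intro!: continuous_intros continuous_on_subset[OF contx])
    then obtain m where m: "m \<in> {z-d..z+d}" "\<And>u. u \<in> {z-d..z+d} \<Longrightarrow> norm (x u) \<le> norm (x m)"
      by auto
    have bound: "norm (x b - x a) \<le> norm (x m) * K * (F b - F a)"
      if ab: "a \<le> b" "a \<in> {z-d..z+d}" "b \<in> {z-d..z+d}" for a b
    proof -
      have fab: "f integrable_on {a..b}"
        by (rule integrable_subinterval_real[OF f]) (use ab d in auto)
      have "norm (x b - x a) = norm (integral {a..b} (\<lambda>u. L u *v x u))"
        using integral_unique[OF xint[OF ab(1)]] by simp
      also have "\<dots> \<le> integral {a..b} (\<lambda>u. norm (x m) * K * f u)"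
      proof (rule integral_norm_bound_integral)
        show "(\<lambda>u. L u *v x u) integrable_on {a..b}" using xint[OF ab(1)] by blast
        show "(\<lambda>u. norm (x m) * K * f u) integrable_on {a..b}"
          using fab by (rule integrable_on_mult_right)
        fix u assume u: "u \<in> {a..b}"
        have "norm (L u *v x u) \<le> norm (L u) * norm (x u) * K" by (rule K)
        also have "\<dots> \<le> norm (L u) * norm (x m) * K"
          using m(2)[of u] u ab K by (intro mult_right_mono mult_left_mono) auto
        finally show "norm (L u *v x u) \<le> norm (x m) * K * f u" by (simp add: f_def mult_ac)
      qed
      also have "\<dots> = norm (x m) * K * integral {a..b} f" by simp
      also have "integral {a..b} f = F b - F a"
      proof -
        have "f integrable_on {z-1..b}"
          by (rule integrable_subinterval_real[OF f]) (use ab d in auto)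
        then have "integral {z-1..a} f + integral {a..b} f = integral {z-1..b} f"
          using ab d by (intro Henstock_Kurzweil_Integration.integral_combine) auto
        then show ?thesis by (simp add: F_def)
      qed
      finally show ?thesis .
    qed
    have "dist m z \<le> d" using m(1) by (auto simp: dist_real_def)
    then have "\<bar>F m - F z\<bar> \<le> 1 / (2 * K)"
      using d0(2)[of m] d(3) by (auto simp: dist_real_def)
    \<comment> \<open>As \<open>x z = 0\<close>, the increment between \<open>z\<close> and
      \<open>m\<close> is \<open>x m\<close> up to sign; the cases are the two orientations.\<close>
    moreover have "norm (x m) \<le> norm (x m) * K * \<bar>F m - F z\<bar>"
    proof (cases "z \<le> m")
      case True
      have "norm (x m) \<le> norm (x m) * K * (F m - F z)"
        using bound[of z m] True m(1) d z by auto
      also have "\<dots> \<le> norm (x m) * K * \<bar>F m - F z\<bar>"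
        using K by (intro mult_left_mono) auto
      finally show ?thesis .
    next
      case False
      have "norm (x m) \<le> norm (x m) * K * (F z - F m)"
        using bound[of m z] False m(1) d z by auto
      also have "\<dots> \<le> norm (x m) * K * \<bar>F m - F z\<bar>"
        using K by (intro mult_left_mono) auto
      finally show ?thesis .
    qed
    ultimately have "norm (x m) \<le> norm (x m) * K * (1 / (2 * K))"
      using K by (meson mult_left_mono mult_nonneg_nonneg norm_ge_zero order_trans less_imp_le)
    then have "norm (x m) \<le> norm (x m) / 2" using K by simp
    then have "norm (x m) \<le> 0" by linarith
    then have "x u = 0" if "dist u z < d" for u
    proof -
      have "u \<in> {z-d..z+d}" using that by (simp add: dist_real_def abs_less_iff)
      then show ?thesis using m(2)[of u] \<open>norm (x m) \<le> 0\<close> by simp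
    qed
    then show "\<exists>e>0. \<forall>y. dist y z < e \<longrightarrow> y \<in> Z"
      using d by (auto simp: Z_def)
  qed
  then have "Z = UNIV"
    using \<open>closed Z\<close> \<open>x s = 0\<close> connected_UNIV[where 'a=real] unfolding connected_clopen
    by (auto simp: Z_def)
  then show ?thesis by (auto simp: Z_def)
qed

text \<open>The integrand is integrable because \<open>\<Psi>\<close> is bounded on compact
  intervals. Additivity of the integral frees the equation from the base point
  \<open>s\<close>.\<close>

lemma linear_ode_solution_principal:
  fixes L :: "real \<Rightarrow> real^'n^'n"
  assumes L: "locally_integrable L" and \<Psi>: "principal_matrix_solution L \<Psi>"
  shows "linear_ode_solution L (\<lambda>u. \<Psi> u s *v v)"
proof -
  define G where "G = (\<lambda>u. L u ** \<Psi> u s)"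
  have cont: "continuous_on UNIV (\<lambda>t. \<Psi> t s)"
    and eq: "\<And>t. \<Psi> t s = mat 1 + (LINT u=ereal s..ereal t|lebesgue. G u)"
    using \<Psi> unfolding principal_matrix_solution_def G_def by blast+
  have G: "G absolutely_integrable_on {a..b}" for a b
    unfolding G_def
  proof (rule absolutely_integrable_bounded_measurable_product[where h="\<lambda>f g. g ** f"])
    show "bilinear (\<lambda>(f::real^'n^'n) g::real^'n^'n. g ** f)"
      using bilinear_matrix_matrix_mult by (auto simp: bilinear_def)
    have c: "continuous_on {a..b} (\<lambda>u. \<Psi> u s)" using cont by (rule continuous_on_subset) simp
    then show "(\<lambda>u. \<Psi> u s) \<in> borel_measurable (lebesgue_on {a..b})"
      by (rule continuous_imp_measurable_on_sets_lebesgue) simp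
    show "bounded ((\<lambda>u. \<Psi> u s) ` {a..b})"
      by (rule compact_imp_bounded[OF compact_continuous_image[OF c]]) simp
    show "L absolutely_integrable_on {a..b}" using L by (simp add: locally_integrable_def)
  qed simp
  have GI: "G integrable_on {a..b}" for a b
    using G by (rule set_lebesgue_integral_eq_integral)
  have Goo: "(LINT u:{a<..<b}|lebesgue. G u) = integral {a..b} G" for a b
  proof -
    have "G absolutely_integrable_on {a<..<b}"
      by (rule set_integrable_subset[OF G[of a b]]) auto
    then have "(LINT u:{a<..<b}|lebesgue. G u) = integral {a<..<b} G"
      by (rule set_lebesgue_integral_eq_integral)
    then show ?thesis by (simp add: integral_open_interval_real)
  qed
  have right: "\<Psi> t s = mat 1 + integral {s..t} G" if "s \<le> t" for t
    using that eq[of t] by (simp add: interval_lebesgue_integral_le_eq Goo)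
  \<comment> \<open>The formula for reversed limits needs \<open>t < s\<close>, so
    \<open>t = s\<close> is treated apart.\<close>
  have left: "\<Psi> t s = mat 1 - integral {t..s} G" if "t \<le> s" for t
    using that eq[of t] right[of t] by (cases "t = s") (simp_all add: interval_lebesgue_integral_gt_eq Goo)
  have \<Psi>int: "(G has_integral (\<Psi> b s - \<Psi> a s)) {a..b}" if ab: "a \<le> b" for a b
  proof -
    have comb: "integral {p..q} G + integral {q..r} G = integral {p..r} G" if "p \<le> q" "q \<le> r" for p q r
      using that GI by (rule Henstock_Kurzweil_Integration.integral_combine)
    consider "s \<le> a" | "a \<le> s" "s \<le> b" | "b \<le> s" by linarith
    then have "\<Psi> b s - \<Psi> a s = integral {a..b} G"
    proof cases
      case 1 then show ?thesis using ab comb[of s a b] by (simp add: right[of a] right[of b] algebra_simps)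
    next
      case 2 then show ?thesis using ab comb[of a s b] by (simp add: left[of a] right[of b] algebra_simps)
    next
      case 3 then show ?thesis using ab comb[of a b s] by (simp add: left[of a] left[of b] algebra_simps)
    qed
    then show ?thesis using GI[of a b] by (simp add: has_integral_iff)
  qed
  have lin: "bounded_linear (\<lambda>M::real^'n^'n. M *v v)"
    using bilinear_matrix_vector_mult by (auto simp: bilinear_def linear_conv_bounded_linear)
  show ?thesis
    unfolding linear_ode_solution_def
  proof (intro conjI allI impI)
    show "continuous_on UNIV (\<lambda>u. \<Psi> u s *v v)"
      by (rule bounded_linear.continuous_on[OF lin cont])
    fix a b :: real assume "a \<le> b"
    from has_integral_linear[OF \<Psi>int[OF this] lin]
    show "((\<lambda>u. L u *v (\<Psi> u s *v v)) has_integral \<Psi> b s *v v - \<Psi> a s *v v) {a..b}"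
      by (simp add: o_def G_def matrix_vector_mul_assoc matrix_vector_mult_diff_rdistrib)
  qed
qed

lemma principal_matrix_solution_same:
  assumes "principal_matrix_solution L \<Psi>"
  shows "\<Psi> s s = mat 1"
proof -
  have "\<Psi> s s = mat 1 + (LINT u=ereal s..ereal s|lebesgue. (L u ** \<Psi> u s))"
    using assms unfolding principal_matrix_solution_def by blast
  then show ?thesis by (simp add: interval_lebesgue_integral_def set_lebesgue_integral_def)
qed

text \<open>As functions of \<open>t\<close>, both sides solve the same equation and agree at
  \<open>t = s\<close>.\<close>

lemma principal_matrix_solution_cocycle:
  assumes L: "locally_integrable L" and \<Psi>: "principal_matrix_solution L \<Psi>"
  shows "\<Psi> t s *v (\<Psi> s r *v v) = \<Psi> t r *v v"
proof -
  have "linear_ode_solution L (\<lambda>u. \<Psi> u s *v (\<Psi> s r *v v) - \<Psi> u r *v v)"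
    by (intro linear_ode_solution_diff linear_ode_solution_principal L \<Psi>)
  then have "\<Psi> t s *v (\<Psi> s r *v v) - \<Psi> t r *v v = 0"
    by (rule linear_ode_solution_unique[OF L, where s=s])
       (simp add: principal_matrix_solution_same[OF \<Psi>])
  then show ?thesis by simp
qed

lemma norm_matrix_vector_le_onorm:
  fixes M :: "real^'n^'m"
  shows "norm (M *v v) \<le> onorm (\<lambda>v. M *v v) * norm v"
  by (rule onorm) (simp add: matrix_vector_mul_bounded_linear)

text \<open>The hypotheses give continuity in the first argument only. The cocycle law makes
  \<open>\<Psi> t s\<close> the inverse of \<open>\<Psi> s t\<close>, and the uniform bound
  \<open>K\<close> carries continuity over to the inverse.\<close>

lemma continuous_on_principal_matrix_solution_start:
  fixes L :: "real \<Rightarrow> real^'n^'n"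
  assumes L: "locally_integrable L" and \<Psi>: "principal_matrix_solution L \<Psi>"
    and bound: "\<And>s. s \<le> t \<Longrightarrow> onorm (\<lambda>v. \<Psi> t s *v v) \<le> K"
  shows "continuous_on {..t} (\<lambda>s. \<Psi> t s *v v)"
  unfolding continuous_on_def
proof
  fix s0 assume s0: "s0 \<in> {..t}"
  define w where "w = \<Psi> t s0 *v v"
  have inv: "\<Psi> p q *v (\<Psi> q p *v y) = y" for p q y
    using principal_matrix_solution_cocycle[OF L \<Psi>, of p q p y] principal_matrix_solution_same[OF \<Psi>]
    by simp
  have v: "v = \<Psi> s0 t *v w" by (simp add: w_def inv)
  have "continuous_on UNIV (\<lambda>s. \<Psi> s t *v w)"
    using linear_ode_solution_principal[OF L \<Psi>, of t w] by (simp add: linear_ode_solution_def)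
  then have "((\<lambda>s. \<Psi> s t *v w) \<longlongrightarrow> \<Psi> s0 t *v w) (at s0 within {..t})"
    by (meson UNIV_I continuous_on_def subset_UNIV tendsto_within_subset)
  then have "((\<lambda>s. K * norm (\<Psi> s0 t *v w - \<Psi> s t *v w)) \<longlongrightarrow> K * norm (\<Psi> s0 t *v w - \<Psi> s0 t *v w))
      (at s0 within {..t})"
    by (intro tendsto_intros)
  then have lim: "((\<lambda>s. K * norm (\<Psi> s0 t *v w - \<Psi> s t *v w)) \<longlongrightarrow> 0) (at s0 within {..t})"
    by simp
  have "norm (\<Psi> t s *v v - \<Psi> t s0 *v v) \<le> K * norm (\<Psi> s0 t *v w - \<Psi> s t *v w)" if "s \<le> t" for s
  proof -
    \<comment> \<open>Write \<open>v\<close> as \<open>\<Psi> s0 t *v w\<close>, and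
      \<open>w\<close> as \<open>\<Psi> t s *v (\<Psi> s t *v w)\<close>.\<close>
    have "\<Psi> t s *v v - \<Psi> t s0 *v v = \<Psi> t s *v (\<Psi> s0 t *v w - \<Psi> s t *v w)"
      using v by (simp add: matrix_vector_mult_diff_distrib inv w_def)
    also have "norm \<dots> \<le> onorm (\<lambda>v. \<Psi> t s *v v) * norm (\<Psi> s0 t *v w - \<Psi> s t *v w)"
      by (rule norm_matrix_vector_le_onorm)
    also have "\<dots> \<le> K * norm (\<Psi> s0 t *v w - \<Psi> s t *v w)"
      using bound[OF that] by (intro mult_right_mono) auto
    finally show ?thesis .
  qed
  then have "\<forall>\<^sub>F s in at s0 within {..t}.
      norm (\<Psi> t s *v v - \<Psi> t s0 *v v) \<le> K * norm (\<Psi> s0 t *v w - \<Psi> s t *v w)"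
    by (auto simp: eventually_at_filter)
  then have "((\<lambda>s. \<Psi> t s *v v - \<Psi> t s0 *v v) \<longlongrightarrow> 0) (at s0 within {..t})"
    by (rule Lim_null_comparison[OF _ lim])
  then show "((\<lambda>s. \<Psi> t s *v v) \<longlongrightarrow> \<Psi> t s0 *v v) (at s0 within {..t})"
    by (rule Lim_null[THEN iffD2])
qed

subsection \<open>Attractor fibres\<close>

lemma Linf_unit_ball_iff:
  "\<xi> \<in> Linf_unit_ball \<longleftrightarrow> \<xi> \<in> borel_measurable lebesgue \<and> (AE s in lebesgue. norm (\<xi> s) \<le> 1)"
proof (cases "\<xi> \<in> borel_measurable lebesgue")
  case True
  then have [measurable]: "(\<lambda>s. ereal (norm (\<xi> s))) \<in> borel_measurable lebesgue" by measurable
  have "AE s in lebesgue. norm (\<xi> s) \<le> 1" if "esssup lebesgue (\<lambda>s. ereal (norm (\<xi> s))) \<le> 1"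
    using esssup_AE[of "\<lambda>s. ereal (norm (\<xi> s))" lebesgue]
  proof eventually_elim
    case (elim s)
    then have "ereal (norm (\<xi> s)) \<le> 1" using that by (rule order_trans)
    then show ?case by simp
  qed
  moreover have "esssup lebesgue (\<lambda>s. ereal (norm (\<xi> s))) \<le> 1" if "AE s in lebesgue. norm (\<xi> s) \<le> 1"
    by (rule esssup_I) (use that in auto)
  ultimately show ?thesis using True by (auto simp: Linf_unit_ball_def)
qed (auto simp: Linf_unit_ball_def)

text \<open>The reflection \<open>s \<mapsto> t - s\<close> reduces this to the half-line
  \<open>{0..}\<close>. The substitution takes place in \<open>lborel\<close>, reached from
  \<open>lebesgue\<close> and back because the integrand is Borel.\<close>

lemma set_integrable_exp_atMost:
  fixes \<gamma> :: real
  assumes "\<gamma> > 0"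
  shows "set_integrable lebesgue {..t} (\<lambda>s. exp (- \<gamma> * (t - s)))"
proof -
  have "(\<lambda>x. exp (- \<gamma> * x)) absolutely_integrable_on {0..}"
    by (rule nonnegative_absolutely_integrable_1)
       (use has_integral_exp_minus_to_infinity[OF assms, of 0] in auto)
  then have "integrable lebesgue (\<lambda>x. indicator {0..} x *\<^sub>R exp (- \<gamma> * x))"
    by (simp add: set_integrable_def)
  then have "integrable lborel (\<lambda>x. indicator {0..} x *\<^sub>R exp (- \<gamma> * x))"
    by (subst (asm) integrable_completion) measurable
  then have "integrable lborel (\<lambda>s. indicator {0..} (t + (- 1) * s) *\<^sub>R exp (- \<gamma> * (t + (- 1) * s)))"
    by (rule lborel_integrable_real_affine) simp
  also have "(\<lambda>s. indicator {0..} (t + (- 1) * s) *\<^sub>R exp (- \<gamma> * (t + (- 1) * s)))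
      = (\<lambda>s. indicator {..t} s *\<^sub>R exp (- \<gamma> * (t - s)))"
    by (auto simp: indicator_def)
  finally show ?thesis
    unfolding set_integrable_def by (subst integrable_completion) measurable
qed

text \<open>A vanishing integral makes \<open>f\<close> zero almost everywhere. Its zero set is
  closed, so it contains \<open>{..<t}\<close> and then also the endpoint \<open>t\<close>, although
  a single point is null.\<close>

lemma set_integral_atMost_pos:
  fixes f :: "real \<Rightarrow> real"
  assumes cont: "continuous_on {..t} f" and int: "set_integrable lebesgue {..t} f"
    and nonneg: "\<And>s. s \<le> t \<Longrightarrow> f s \<ge> 0" and "f t \<noteq> 0"
  shows "(LINT s:{..t}|lebesgue. f s) > 0"
proof -
  have nn: "AE s in lebesgue. 0 \<le> indicator {..t} s *\<^sub>R f s"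
    using nonneg by (auto simp: indicator_def)
  have "(LINT s:{..t}|lebesgue. f s) \<noteq> 0"
  proof
    assume "(LINT s:{..t}|lebesgue. f s) = 0"
    then have ae: "AE s in lebesgue. indicator {..t} s *\<^sub>R f s = 0"
      using integral_nonneg_eq_0_iff_AE[OF int[unfolded set_integrable_def] nn]
      by (simp add: set_lebesgue_integral_def)
    define C where "C = {s \<in> {..t}. f s = 0}"
    have C: "closed C"
      using continuous_closed_preimage_constant[OF cont closed_atMost] by (simp add: C_def)
    have "s \<in> C" if "s \<in> {..<t}" for s
    proof (rule mem_closed_if_AE_lebesgue_open[OF _ C _ that])
      show "AE s\<in>{..<t} in lebesgue. s \<in> C"
        using ae by eventually_elim (auto simp: C_def)
    qed simp
    then have "closure {..<t} \<subseteq> C" by (intro closure_minimal C) auto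
    then have "t \<in> C" by auto
    then show False using \<open>f t \<noteq> 0\<close> by (simp add: C_def)
  qed
  moreover have "(LINT s:{..t}|lebesgue. f s) \<ge> 0"
    unfolding set_lebesgue_integral_def by (rule integral_nonneg_AE[OF nn])
  ultimately show ?thesis by simp
qed

lemma measurable_indicator_continuous_lebesgue:
  fixes f :: "real \<Rightarrow> 'a::euclidean_space"
  assumes "continuous_on {..t} f"
  shows "(\<lambda>s. indicator {..t} s *\<^sub>R f s) \<in> borel_measurable lebesgue"
  by (rule measurable_completion) (use borel_measurable_continuous_on_indicator[OF _ assms] in simp)

text \<open>Here \<open>\<Phi>\<close> stands for \<open>\<Psi> t\<close>. The dynamics enter only
  through strong continuity, the identity at the endpoint and an integrable bound.\<close>

lemma C1_submanifold_frontier_convolution_set: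
  fixes \<Phi> :: "real \<Rightarrow> real^'n^'n"
  assumes cont: "\<And>v. continuous_on {..t} (\<lambda>s. \<Phi> s *v v)"
    and \<Phi>t: "\<Phi> t = mat 1"
    and E: "set_integrable lebesgue {..t} E"
    and bound: "\<And>s. s \<le> t \<Longrightarrow> onorm (\<lambda>v. \<Phi> s *v v) \<le> E s"
    and \<rho>: "\<rho> > 0"
  shows "C1_submanifold (CARD('n) - 1)
           (frontier {\<rho> *\<^sub>R (LINT s:{..t}|lebesgue. \<Phi> s *v \<xi> s) | \<xi>. \<xi> \<in> Linf_unit_ball})"
proof -
  define I where "I = (\<lambda>\<xi>. LINT s:{..t}|lebesgue. \<Phi> s *v \<xi> s)"
  define A where "A = {\<rho> *\<^sub>R I \<xi> | \<xi>. \<xi> \<in> Linf_unit_ball}"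
  \<comment> \<open>Moving the matrix to \<open>r\<close> turns the integrand into
    \<open>T r s \<bullet> \<xi> s\<close>, which can be maximised over the unit ball separately for
    each \<open>s\<close>.\<close>
  define T where "T = (\<lambda>r s. transpose (\<Phi> s) *v r)"
  define h where "h = (\<lambda>r. \<rho> * (LINT s:{..t}|lebesgue. norm (T r s)))"
  have T: "T r s \<bullet> v = r \<bullet> (\<Phi> s *v v)" for r s v
    by (simp add: T_def dot_lmul_matrix vector_transpose_matrix)
  have contT: "continuous_on {..t} (T r)" for r
  proof (rule continuous_on_componentwise[THEN iffD2], intro ballI)
    fix i :: "real^'n"
    show "continuous_on {..t} (\<lambda>s. T r s \<bullet> i)"
      unfolding T by (intro continuous_intros cont)
  qed
  have E0: "norm (\<Phi> s *v v) \<le> E s * norm v" if "s \<le> t" for s v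
    using norm_matrix_vector_le_onorm[of "\<Phi> s" v] bound[OF that]
    by (meson mult_right_mono norm_ge_zero order_trans)
  have normT: "norm (T r s) \<le> E s * norm r" if "s \<le> t" for r s
  proof (cases "T r s = 0")
    case True
    have "0 \<le> E s * norm r" using E0[OF that, of r] norm_ge_zero order_trans by blast
    then show ?thesis using True by simp
  next
    case False
    \<comment> \<open>The bound passes to the transpose by testing against \<open>T r s\<close>
      itself and cancelling one factor of its norm.\<close>
    have "norm (T r s) * norm (T r s) = r \<bullet> (\<Phi> s *v T r s)"
      by (simp add: T[symmetric] dot_square_norm power2_eq_square)
    also have "\<dots> \<le> norm r * norm (\<Phi> s *v T r s)" by (rule norm_cauchy_schwarz)
    also have "\<dots> \<le> norm r * (E s * norm (T r s))" by (intro mult_left_mono E0 that) auto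
    finally show ?thesis using False by (simp add: mult_ac)
  qed
  have intT: "set_integrable lebesgue {..t} (\<lambda>s. norm (T r s))" for r
  proof (rule set_integrable_bound)
    show "set_integrable lebesgue {..t} (\<lambda>s. E s * norm r)" using E by simp
    show "set_borel_measurable lebesgue {..t} (\<lambda>s. norm (T r s))"
      unfolding set_borel_measurable_def
      by (rule measurable_indicator_continuous_lebesgue) (intro continuous_on_norm contT)
    show "AE s in lebesgue. s \<in> {..t} \<longrightarrow> norm (norm (T r s)) \<le> norm (E s * norm r)"
    proof (intro AE_I2 impI)
      fix s assume "s \<in> {..t}"
      then have "norm (T r s) \<le> E s * norm r" using normT by simp
      also have "\<dots> \<le> norm (E s * norm r)" unfolding real_norm_def by (rule abs_ge_self)
      finally show "norm (norm (T r s)) \<le> norm (E s * norm r)" by simp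
    qed
  qed
  have int\<xi>: "set_integrable lebesgue {..t} (\<lambda>s. \<Phi> s *v \<xi> s)" if \<xi>: "\<xi> \<in> Linf_unit_ball" for \<xi>
  proof (rule set_integrable_bound[OF E])
    have [measurable]: "\<xi> \<in> borel_measurable lebesgue" using \<xi> by (simp add: Linf_unit_ball_iff)
    \<comment> \<open>Continuity, hence measurability, is known for \<open>\<Phi>\<close> applied to
      fixed vectors, so \<open>\<xi> s\<close> is expanded in coordinates.\<close>
    have eq: "indicator {..t} s *\<^sub>R (\<Phi> s *v \<xi> s)
        = (\<Sum>j\<in>UNIV. \<xi> s $ j *\<^sub>R (indicator {..t} s *\<^sub>R (\<Phi> s *v axis j 1)))" for s
    proof -
      have "\<Phi> s *v \<xi> s = \<Phi> s *v (\<Sum>j\<in>UNIV. \<xi> s $ j *\<^sub>R axis j 1)"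
        using basis_expansion[of "\<xi> s"] by (simp add: scalar_mult_eq_scaleR)
      also have "\<dots> = (\<Sum>j\<in>UNIV. \<xi> s $ j *\<^sub>R (\<Phi> s *v axis j 1))"
        by (simp add: linear_sum[OF matrix_vector_mul_linear] matrix_vector_mult_scaleR)
      finally show ?thesis by (simp add: scaleR_sum_right mult_ac)
    qed
    have [measurable]: "(\<lambda>s. indicator {..t} s *\<^sub>R (\<Phi> s *v axis j 1)) \<in> borel_measurable lebesgue" for j
      by (rule measurable_indicator_continuous_lebesgue[OF cont])
    have [measurable]: "(\<lambda>s. \<xi> s $ j) \<in> borel_measurable lebesgue" for j
      by (rule measurable_compose[OF _ borel_measurable_nth]) simp
    show "set_borel_measurable lebesgue {..t} (\<lambda>s. \<Phi> s *v \<xi> s)"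
      unfolding set_borel_measurable_def eq
      by (rule borel_measurable_sum, rule borel_measurable_scaleR) simp_all
    have "AE s in lebesgue. norm (\<xi> s) \<le> 1" using \<xi> by (simp add: Linf_unit_ball_iff)
    then show "AE s in lebesgue. s \<in> {..t} \<longrightarrow> norm (\<Phi> s *v \<xi> s) \<le> norm (E s)"
    proof eventually_elim
      case (elim s)
      have "norm (\<Phi> s *v \<xi> s) \<le> norm (E s)" if "s \<le> t"
      proof -
        have "norm (\<Phi> s *v \<xi> s) \<le> E s * norm (\<xi> s)" by (rule E0[OF that])
        also have "\<dots> \<le> norm (E s) * 1" using elim by (intro mult_mono) auto
        finally show ?thesis by simp
      qed
      then show ?case by simp
    qed
  qed
  have inner_I: "r \<bullet> I \<xi> = (LINT s:{..t}|lebesgue. T r s \<bullet> \<xi> s)"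
    and inner_int: "set_integrable lebesgue {..t} (\<lambda>s. T r s \<bullet> \<xi> s)"
    if "\<xi> \<in> Linf_unit_ball" for \<xi> r
  proof -
    note i = int\<xi>[OF that, unfolded set_integrable_def]
    have "r \<bullet> I \<xi> = (LINT s|lebesgue. r \<bullet> (indicator {..t} s *\<^sub>R (\<Phi> s *v \<xi> s)))"
      unfolding I_def set_lebesgue_integral_def by (rule integral_inner_right[symmetric]) (use i in simp)
    then show "r \<bullet> I \<xi> = (LINT s:{..t}|lebesgue. T r s \<bullet> \<xi> s)"
      by (simp add: set_lebesgue_integral_def T)
    have "integrable lebesgue (\<lambda>s. r \<bullet> (indicator {..t} s *\<^sub>R (\<Phi> s *v \<xi> s)))"
      by (rule integrable_inner_right) (use i in simp)
    then show "set_integrable lebesgue {..t} (\<lambda>s. T r s \<bullet> \<xi> s)"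
      by (simp add: set_integrable_def T)
  qed
  have "convex A"
  proof (rule convexI)
    fix a b u v assume a: "a \<in> A" and b: "b \<in> A" and uv: "0 \<le> u" "0 \<le> v" "u + v = (1::real)"
    obtain \<xi> where \<xi>: "\<xi> \<in> Linf_unit_ball" "a = \<rho> *\<^sub>R I \<xi>" using a by (auto simp: A_def)
    obtain \<eta> where \<eta>: "\<eta> \<in> Linf_unit_ball" "b = \<rho> *\<^sub>R I \<eta>" using b by (auto simp: A_def)
    define \<zeta> where "\<zeta> = (\<lambda>s. u *\<^sub>R \<xi> s + v *\<^sub>R \<eta> s)"
    have "AE s in lebesgue. norm (\<xi> s) \<le> 1" "AE s in lebesgue. norm (\<eta> s) \<le> 1"
      using \<xi> \<eta> by (simp_all add: Linf_unit_ball_iff)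
    then have "AE s in lebesgue. norm (\<zeta> s) \<le> 1"
    proof eventually_elim
      case (elim s)
      have "norm (\<zeta> s) \<le> u * norm (\<xi> s) + v * norm (\<eta> s)"
        unfolding \<zeta>_def using norm_triangle_ineq[of "u *\<^sub>R \<xi> s" "v *\<^sub>R \<eta> s"] uv by simp
      also have "\<dots> \<le> 1" using elim uv by (intro convex_bound_le) auto
      finally show ?case .
    qed
    moreover have "\<zeta> \<in> borel_measurable lebesgue"
      unfolding \<zeta>_def using \<xi> \<eta> by (auto simp: Linf_unit_ball_iff)
    ultimately have "\<zeta> \<in> Linf_unit_ball" by (simp add: Linf_unit_ball_iff)
    moreover have "I \<zeta> = u *\<^sub>R I \<xi> + v *\<^sub>R I \<eta>"
    proof -
      have "I \<zeta> = (LINT s:{..t}|lebesgue. u *\<^sub>R (\<Phi> s *v \<xi> s) + v *\<^sub>R (\<Phi> s *v \<eta> s))"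
        by (simp add: I_def \<zeta>_def matrix_vector_right_distrib matrix_vector_mult_scaleR)
      also have "\<dots> = u *\<^sub>R I \<xi> + v *\<^sub>R I \<eta>"
        using int\<xi>[OF \<xi>(1)] int\<xi>[OF \<eta>(1)] by (subst set_integral_add) (simp_all add: I_def)
      finally show ?thesis .
    qed
    ultimately show "u *\<^sub>R a + v *\<^sub>R b \<in> A"
      unfolding A_def \<xi>(2) \<eta>(2) by (auto intro!: exI[of _ \<zeta>] simp: algebra_simps)
  qed
  moreover have "r \<bullet> a \<le> h r" if "a \<in> A" for a r
  proof -
    obtain \<xi> where \<xi>: "\<xi> \<in> Linf_unit_ball" "a = \<rho> *\<^sub>R I \<xi>" using \<open>a \<in> A\<close> by (auto simp: A_def)
    have "(LINT s:{..t}|lebesgue. T r s \<bullet> \<xi> s) \<le> (LINT s:{..t}|lebesgue. norm (T r s))"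
      unfolding set_lebesgue_integral_def
    proof (rule integral_mono_AE)
      have "AE s in lebesgue. norm (\<xi> s) \<le> 1" using \<xi> by (simp add: Linf_unit_ball_iff)
      then show "AE s in lebesgue. indicator {..t} s *\<^sub>R (T r s \<bullet> \<xi> s) \<le> indicator {..t} s *\<^sub>R norm (T r s)"
      proof eventually_elim
        case (elim s)
        have "T r s \<bullet> \<xi> s \<le> norm (T r s) * norm (\<xi> s)" by (rule norm_cauchy_schwarz)
        also have "\<dots> \<le> norm (T r s)" using elim by (simp add: mult_left_le)
        finally show ?case by (simp add: indicator_def)
      qed
    qed (use inner_int[OF \<xi>(1)] intT in \<open>simp_all add: set_integrable_def\<close>)
    then show ?thesis using \<rho> by (simp add: \<xi>(2) inner_I[OF \<xi>(1)] h_def)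
  qed
  moreover have "\<exists>a\<in>A. r \<bullet> a = h r" for r
  proof
    \<comment> \<open>The extremal control. The indicator makes it measurable on the whole line, and
      \<open>sgn 0 = 0\<close> keeps it in the unit ball where \<open>T r s\<close>
      vanishes.\<close>
    define \<xi> where "\<xi> = (\<lambda>s. sgn (indicator {..t} s *\<^sub>R T r s))"
    have [measurable]: "(\<lambda>s. indicator {..t} s *\<^sub>R T r s) \<in> borel_measurable lebesgue"
      by (rule measurable_indicator_continuous_lebesgue[OF contT])
    have "\<xi> \<in> borel_measurable lebesgue"
      unfolding \<xi>_def sgn_div_norm by measurable
    then have \<xi>: "\<xi> \<in> Linf_unit_ball" by (simp add: Linf_unit_ball_iff \<xi>_def norm_sgn)
    show "\<rho> *\<^sub>R I \<xi> \<in> A" using \<xi> by (auto simp: A_def)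
    have "indicator {..t} s *\<^sub>R (T r s \<bullet> \<xi> s) = indicator {..t} s *\<^sub>R norm (T r s)" for s
      by (cases "T r s = 0")
         (auto simp: \<xi>_def indicator_def sgn_div_norm dot_square_norm power2_eq_square)
    then show "r \<bullet> (\<rho> *\<^sub>R I \<xi>) = h r"
      by (simp only: inner_scaleR_right inner_I[OF \<xi>] h_def set_lebesgue_integral_def)
  qed
  moreover have "h r > 0" if "r \<noteq> 0" for r
    unfolding h_def
    by (intro mult_pos_pos \<rho> set_integral_atMost_pos continuous_on_norm contT intT)
       (use that in \<open>simp_all add: T_def \<Phi>t\<close>)
  moreover have "norm r *\<^sub>R s = norm s *\<^sub>R r" if eq: "h (r + s) = h r + h s" for r s
  proof (rule ccontr)
    assume "norm r *\<^sub>R s \<noteq> norm s *\<^sub>R r"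
    then have ne: "norm (r + s) \<noteq> norm r + norm s" by (simp add: norm_triangle_eq)
    have add: "T (r + s) u = T r u + T s u" for u
      unfolding T_def by (rule matrix_vector_right_distrib)
    \<comment> \<open>The gap in the triangle inequality is nonnegative throughout and nonzero at
      \<open>u = t\<close>, where \<open>T\<close> is the identity in \<open>r\<close>; its integral
      is therefore positive.\<close>
    have "0 < (LINT u:{..t}|lebesgue. norm (T r u) + norm (T s u) - norm (T (r + s) u))"
    proof (rule set_integral_atMost_pos)
      show "continuous_on {..t} (\<lambda>u. norm (T r u) + norm (T s u) - norm (T (r + s) u))"
        by (intro continuous_intros contT)
      show "set_integrable lebesgue {..t} (\<lambda>u. norm (T r u) + norm (T s u) - norm (T (r + s) u))"
        by (intro set_integral_diff(1) set_integral_add(1) intT)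
      show "0 \<le> norm (T r u) + norm (T s u) - norm (T (r + s) u)" for u
        by (simp add: add norm_triangle_ineq)
      show "norm (T r t) + norm (T s t) - norm (T (r + s) t) \<noteq> 0"
        using ne by (simp add: T_def \<Phi>t transpose_mat)
    qed
    also have "\<dots> = (LINT u:{..t}|lebesgue. norm (T r u)) + (LINT u:{..t}|lebesgue. norm (T s u))
        - (LINT u:{..t}|lebesgue. norm (T (r + s) u))"
      by (simp add: set_integral_diff(2) set_integral_add intT)
    finally have "0 < \<rho> * ((LINT u:{..t}|lebesgue. norm (T r u)) + (LINT u:{..t}|lebesgue. norm (T s u))
        - (LINT u:{..t}|lebesgue. norm (T (r + s) u)))"
      using \<rho> by simp
    then show False using eq by (simp add: h_def algebra_simps)
  qed
  ultimately have "C1_submanifold (DIM(real^'n) - 1) (frontier A)"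
    by (rule C1_submanifold_frontier_support)
  then show ?thesis by (simp add: A_def I_def)
qed

theorem theorem4p10:
  fixes L :: "real \<Rightarrow> real^'n^'n"
    and \<Psi> :: "real \<Rightarrow> real \<Rightarrow> real^'n^'n"
    and \<rho> :: real
    and A :: "real \<Rightarrow> (real^'n) set"
  assumes "CARD('n) \<ge> 2"
    and "\<rho> > 0"
    and "locally_integrable L"
    and "principal_matrix_solution L \<Psi>"
    and "exponentially_stable \<Psi>"
    and "\<And>t. A t = attractor_fibre \<rho> \<Psi> t"
  shows "\<forall>t. C1_submanifold (CARD('n) - 1) (frontier (A t))"
proof
  fix t
  obtain K \<gamma> where K: "K \<ge> 1" "\<gamma> > 0"
    and stable: "\<And>s. s \<le> t \<Longrightarrow> onorm (\<lambda>v. \<Psi> t s *v v) \<le> K * exp (- \<gamma> * (t - s))"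
    using \<open>exponentially_stable \<Psi>\<close> unfolding exponentially_stable_def by blast
  \<comment> \<open>Stability is used twice: as a uniform bound for continuity in \<open>s\<close>,
    and below as an integrable majorant.\<close>
  have "onorm (\<lambda>v. \<Psi> t s *v v) \<le> K" if "s \<le> t" for s
  proof -
    have "K * exp (- \<gamma> * (t - s)) \<le> K * 1"
      using K that by (intro mult_left_mono) auto
    then show ?thesis using stable[OF that] by simp
  qed
  then have "continuous_on {..t} (\<lambda>s. \<Psi> t s *v v)" for v
    by (rule continuous_on_principal_matrix_solution_start[OF assms(3,4)])
  moreover have "set_integrable lebesgue {..t} (\<lambda>s. K * exp (- \<gamma> * (t - s)))"
    using set_integrable_exp_atMost[OF K(2), of t] by simp
  ultimately show "C1_submanifold (CARD('n) - 1) (frontier (A t))"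
    unfolding assms(6) attractor_fibre_def
    using principal_matrix_solution_same[OF assms(4)] stable \<open>\<rho> > 0\<close>
    by (intro C1_submanifold_frontier_convolution_set)
qed

end
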